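(* Let $n$ be a positive integer and let $\mathbf{C}$ be the class of all potentially partial recursive $n$-ary functions. Let $\{A_i\}_{i\in I}$ be a finite family of subsets of $\mathbb{N}^n$ (i.e. $I$ is finite), and for $K\subseteq I$ write $A_K^\cup=\bigcup_{i\in K}A_i$. Then the family $\{A_i\}_{i\in I}$ is strongly join permitting for $\mathbf{C}$ if and only if, for each subset $K$ of $I$, some recursively enumerable subset of $\mathbb{N}^n$ separates $A_K^\cup\setminus A_{I\setminus K}^\cup$ from $A_{I\setminus K}^\cup\setminus A_K^\cup$.
   Context: Functions are sets of ordered pairs; $f\!\upharpoonright_A$ is the restriction of $f$ to $A\cap\mathrm{dom}(f)$. A partial function from $\mathbb{N}^n$ to $\mathbb{N}$ is potentially partial recursive if it is a restriction of some $n$-ary partial recursive function. A collection $\mathcal{A}$ of sets is strongly join permitting for a class $\mathbf{C}$ of functions if for every function $f$ with $\mathrm{dom}(f)\subseteq\bigcup\mathcal{A}$: if $f\!\upharpoonright_A\in\mathbf{C}$ for all $A\in\mathcal{A}$, then $f\in\mathbf{C}$. A family $\{A_i\}_{i\in I}$ is strongly join permitting for $\mathbf{C}$ if the collection $\{A_i\mid i\in I\}$ is. A set $H$ separates $P$ from $Q$ if $H\supseteq P$ and $H\cap Q=\varnothing$. *)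

theory Defs
  imports Main
begin

text \<open>
  Elements of \<open>\<nat>\<^sup>n\<close> are lists of length \<open>n\<close>; partial functions are maps, with library
  domain \<open>dom\<close> and restriction \<open>|`\<close> (so \<open>f |` A\<close> is the restriction of \<open>f\<close> to \<open>A \<inter> dom f\<close>).
\<close>

definition tuples :: "nat \<Rightarrow> nat list set" where
  "tuples n = {xs. length xs = n}"

definition zero_fun :: "nat \<Rightarrow> nat list \<rightharpoonup> nat" where
  "zero_fun n = (\<lambda>xs. Some 0) |` tuples n"

definition succ_fun :: "nat list \<rightharpoonup> nat" where
  "succ_fun = (\<lambda>xs. Some (Suc (hd xs))) |` tuples 1"

definition proj_fun :: "nat \<Rightarrow> nat \<Rightarrow> nat list \<rightharpoonup> nat" where
  "proj_fun n i = (\<lambda>xs. Some (xs ! i)) |` tuples n"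

text \<open>
  Composition is strict: it is defined only where all inner functions are. The explicit
  restriction to \<open>tuples n\<close> matters only when \<open>fs\<close> is empty.
\<close>

definition comp_fun ::
  "nat \<Rightarrow> (nat list \<rightharpoonup> nat) \<Rightarrow> (nat list \<rightharpoonup> nat) list \<Rightarrow> nat list \<rightharpoonup> nat" where
  "comp_fun n g fs =
     (\<lambda>xs. g (map (\<lambda>f. the (f xs)) fs)) |` {xs \<in> tuples n. \<forall>f\<in>set fs. xs \<in> dom f}"

primrec prim_rec ::
  "(nat list \<rightharpoonup> nat) \<Rightarrow> (nat list \<rightharpoonup> nat) \<Rightarrow> nat list \<Rightarrow> nat \<rightharpoonup> nat" where
  "prim_rec f g xs 0 = f xs"
| "prim_rec f g xs (Suc k) = Option.bind (prim_rec f g xs k) (\<lambda>r. g (k # r # xs))"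

definition prim_rec_fun ::
  "(nat list \<rightharpoonup> nat) \<Rightarrow> (nat list \<rightharpoonup> nat) \<Rightarrow> nat list \<rightharpoonup> nat" where
  "prim_rec_fun f g = (\<lambda>ys. case ys of [] \<Rightarrow> None | k # xs \<Rightarrow> prim_rec f g xs k)"

text \<open>
  Unbounded minimization: \<open>f (z # xs)\<close> must be defined and nonzero for all \<open>z\<close> below the result.
\<close>

definition mu_fun :: "(nat list \<rightharpoonup> nat) \<Rightarrow> nat list \<rightharpoonup> nat" where
  "mu_fun f = (\<lambda>xs.
     if \<exists>y. f (y # xs) = Some 0 \<and> (\<forall>z<y. (z # xs) \<in> dom f)
     then Some (LEAST y. f (y # xs) = Some 0) else None)"

inductive partial_recursive :: "nat \<Rightarrow> (nat list \<rightharpoonup> nat) \<Rightarrow> bool" where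
  zero: "partial_recursive n (zero_fun n)"
| succ: "partial_recursive 1 succ_fun"
| proj: "i < n \<Longrightarrow> partial_recursive n (proj_fun n i)"
| comp: "partial_recursive (length fs) g \<Longrightarrow> \<forall>f\<in>set fs. partial_recursive n f \<Longrightarrow>
    partial_recursive n (comp_fun n g fs)"
| prim_rec: "partial_recursive n f \<Longrightarrow> partial_recursive (n + 2) g \<Longrightarrow>
    partial_recursive (n + 1) (prim_rec_fun f g)"
| mu: "partial_recursive (n + 1) f \<Longrightarrow> partial_recursive n (mu_fun f)"

lemma partial_recursive_dom: "partial_recursive n f \<Longrightarrow> dom f \<subseteq> tuples n"
proof (induction rule: partial_recursive.induct)
  case (prim_rec n f g)
  have "length xs = n" if "prim_rec f g xs k = Some v" for xs k v
    using that prim_rec.IH(1)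
    by (induction k arbitrary: v) (auto simp: tuples_def dom_def split: bind_splits)
  then show ?case
    by (auto simp: prim_rec_fun_def tuples_def split: list.splits)
next
  case (mu n f)
  then show ?case
    by (fastforce simp: mu_fun_def tuples_def split: if_splits)
qed (auto simp: zero_fun_def succ_fun_def proj_fun_def comp_fun_def restrict_map_def
       split: if_splits)

definition potentially_partial_recursive :: "nat \<Rightarrow> (nat list \<rightharpoonup> nat) \<Rightarrow> bool" where
  "potentially_partial_recursive n f \<longleftrightarrow> (\<exists>g D. partial_recursive n g \<and> f = g |` D)"

definition recursively_enumerable :: "nat \<Rightarrow> nat list set \<Rightarrow> bool" where
  "recursively_enumerable n H \<longleftrightarrow> (\<exists>g. partial_recursive n g \<and> H = dom g)"

text \<open>
  Fixing the codomain \<open>'b\<close> of \<open>f\<close> loses nothing: if all the restrictions \<open>f |` A\<close> have values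
  in \<open>'b\<close> and \<open>dom f \<subseteq> \<Union>\<A>\<close>, then so has \<open>f\<close>.
\<close>

definition strongly_join_permitting :: "('a \<rightharpoonup> 'b) set \<Rightarrow> 'a set set \<Rightarrow> bool" where
  "strongly_join_permitting C \<A> \<longleftrightarrow>
     (\<forall>f. dom f \<subseteq> \<Union>\<A> \<longrightarrow> (\<forall>A\<in>\<A>. f |` A \<in> C) \<longrightarrow> f \<in> C)"

definition separates :: "'a set \<Rightarrow> 'a set \<Rightarrow> 'a set \<Rightarrow> bool" where
  "separates H P Q \<longleftrightarrow> P \<subseteq> H \<and> H \<inter> Q = {}"

end

theory Submission
  imports Defs
begin

text \<open>
  Necessity: the function that is \<open>1\<close> on the first of the two differences and \<open>0\<close> on the second
  is constant on every \<open>A i\<close>, and any partial recursive extension \<open>g\<close> of it yields the separating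
  set \<open>{x. g x = 1}\<close>.

  Sufficiency: let \<open>g\<^sub>i\<close> be partial recursive and extend \<open>f\<close> on \<open>A i\<close>, and let \<open>H\<^sub>K\<close> be the given
  separating sets. On input \<open>x\<close>, search for a nonempty \<open>K\<close> and a value \<open>v\<close> such that \<open>x \<in> H\<^sub>K\<close> and
  \<open>g\<^sub>i x = v\<close> for all \<open>i \<in> K\<close>. If \<open>x \<in> dom f\<close> and \<open>S = {i. x \<in> A i}\<close>, then \<open>K = S\<close> with \<open>v = f x\<close>
  is such a pair; conversely \<open>x \<in> H\<^sub>K\<close> forces \<open>K\<close> to meet \<open>S\<close>, so that every such \<open>v\<close> equals \<open>f x\<close>.
  The parallel search rests on a weak normal form: every partial recursive function is the limit
  of a total recursive function that increases with the stage.
\<close>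

section \<open>Total recursive functions\<close>

text \<open>The restriction to \<open>tuples n\<close> makes the basic functions literal instances
  and the values of \<open>F\<close> at other lengths irrelevant.\<close>

definition total_map :: "nat \<Rightarrow> (nat list \<Rightarrow> nat) \<Rightarrow> nat list \<rightharpoonup> nat" where
  "total_map n F = (\<lambda>xs. Some (F xs)) |` tuples n"

definition total_recursive :: "nat \<Rightarrow> (nat list \<Rightarrow> nat) \<Rightarrow> bool" where
  "total_recursive n F \<longleftrightarrow> partial_recursive n (total_map n F)"

lemma total_map_apply: "xs \<in> tuples n \<Longrightarrow> total_map n F xs = Some (F xs)"
  by (simp add: total_map_def)

lemma total_recursive_cong:
  assumes "total_recursive n F" "\<And>xs. length xs = n \<Longrightarrow> F xs = G xs"
  shows "total_recursive n G"
proof -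
  have "total_map n F = total_map n G"
    using assms(2) by (auto simp: total_map_def tuples_def restrict_map_def)
  then show ?thesis
    using assms(1) by (simp add: total_recursive_def)
qed

lemma total_recursive_nth: "i < n \<Longrightarrow> total_recursive n (\<lambda>xs. xs ! i)"
  using partial_recursive.proj[of i n]
  by (simp add: total_recursive_def total_map_def proj_fun_def)

lemma total_recursive_comp:
  assumes "total_recursive (length Fs) G" "\<And>F. F \<in> set Fs \<Longrightarrow> total_recursive n F"
  shows "total_recursive n (\<lambda>xs. G (map (\<lambda>F. F xs) Fs))"
proof -
  have "comp_fun n (total_map (length Fs) G) (map (total_map n) Fs)
      = total_map n (\<lambda>xs. G (map (\<lambda>F. F xs) Fs))"
    by (rule ext)
      (auto simp: comp_fun_def total_map_def restrict_map_def tuples_def comp_def split: if_splits)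
  moreover have "partial_recursive n
      (comp_fun n (total_map (length Fs) G) (map (total_map n) Fs))"
    using assms by (intro partial_recursive.comp) (auto simp: total_recursive_def)
  ultimately show ?thesis
    by (simp add: total_recursive_def)
qed

text \<open>Computed arguments replace the first \<open>d\<close> entries, and projections supply
  the remaining tail, so that a parameter list of any length is handed on as a whole. The length
  condition is \<open>length Fs + (n - d) = m\<close> without subtraction.\<close>

lemma total_recursive_subst:
  assumes "total_recursive m G" "\<And>F. F \<in> set Fs \<Longrightarrow> total_recursive n F"
    "d \<le> n" "length Fs + n = m + d"
  shows "total_recursive n (\<lambda>xs. G (map (\<lambda>F. F xs) Fs @ drop d xs))"
proof -
  let ?Fs = "Fs @ map (\<lambda>i xs. xs ! i) [d..<n]"
  have "total_recursive n (\<lambda>xs. G (map (\<lambda>F. F xs) ?Fs))"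
    using assms by (intro total_recursive_comp) (auto intro: total_recursive_nth)
  moreover have "map (\<lambda>F. F xs) (map (\<lambda>i xs. xs ! i) [d..<n]) = drop d xs"
    if "length xs = n" for xs :: "nat list"
    using that by (auto intro: nth_equalityI)
  then have "G (map (\<lambda>F. F xs) ?Fs) = G (map (\<lambda>F. F xs) Fs @ drop d xs)"
    if "length xs = n" for xs
    using that by simp
  ultimately show ?thesis
    by (rule total_recursive_cong)
qed

lemma total_recursive_Suc:
  assumes "total_recursive n F" shows "total_recursive n (\<lambda>xs. Suc (F xs))"
proof -
  have "total_recursive (length [F]) (\<lambda>xs. Suc (hd xs))"
    using partial_recursive.succ by (simp add: total_recursive_def total_map_def succ_fun_def)
  from total_recursive_comp[OF this, of n] assms show ?thesis
    by simp
qed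

lemma total_recursive_const: "total_recursive n (\<lambda>_. c)"
proof (induction c)
  case 0
  show ?case
    using partial_recursive.zero[of n]
    by (simp add: total_recursive_def total_map_def zero_fun_def)
qed (rule total_recursive_Suc)

lemma total_recursive_prim_rec:
  assumes "total_recursive n F" "total_recursive (n + 2) G"
  shows "total_recursive (Suc n)
    (\<lambda>ys. rec_nat (F (tl ys)) (\<lambda>k r. G (k # r # tl ys)) (hd ys))" (is "total_recursive _ ?R")
proof -
  have "prim_rec (total_map n F) (total_map (n + 2) G) xs k = total_map (Suc n) ?R (k # xs)"
    for k xs
    by (induction k) (auto simp: total_map_def restrict_map_def tuples_def)
  then have "prim_rec_fun (total_map n F) (total_map (n + 2) G) = total_map (Suc n) ?R"
    by (intro ext) (auto simp: prim_rec_fun_def total_map_def tuples_def split: list.splits)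
  then show ?thesis
    using assms partial_recursive.prim_rec unfolding total_recursive_def by fastforce
qed

text \<open>The recursion depth is itself computed: \<open>C\<close> is substituted for the head,
  and \<open>d = 0\<close> keeps all of \<open>xs\<close> as parameters.\<close>

lemma total_recursive_rec_nat:
  assumes "total_recursive n F" "total_recursive (n + 2) G" "total_recursive n C"
  shows "total_recursive n (\<lambda>xs. rec_nat (F xs) (\<lambda>k r. G (k # r # xs)) (C xs))"
  using total_recursive_subst[OF total_recursive_prim_rec[OF assms(1,2)], of "[C]" n 0] assms(3)
  by simp

lemma total_recursive_drop:
  assumes "total_recursive n F" shows "total_recursive (d + n) (\<lambda>xs. F (drop d xs))"
  using total_recursive_subst[OF assms, of "[]" "d + n" d] by simp

text \<open>A recursion of depth \<open>C xs\<close> starts at \<open>F xs\<close>, and each of its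
  steps overwrites the result by \<open>G xs\<close>.\<close>

lemma total_recursive_if_zero:
  assumes "total_recursive n C" "total_recursive n F" "total_recursive n G"
  shows "total_recursive n (\<lambda>xs. if C xs = 0 then F xs else G xs)"
proof -
  have "total_recursive (n + 2) (\<lambda>ys. G (drop 2 ys))"
    using total_recursive_drop[OF assms(3), of 2] by (simp add: add.commute)
  from total_recursive_rec_nat[OF assms(2) this assms(1)] show ?thesis
    by (rule total_recursive_cong) (auto split: nat.splits simp: gr0_conv_Suc)
qed

lemma total_recursive_pred:
  assumes "total_recursive n F" shows "total_recursive n (\<lambda>xs. F xs - 1)"
proof -
  \<comment> \<open>Each step returns its counter, so the last one yields the predecessor.\<close>
  have "total_recursive n (\<lambda>xs. rec_nat 0 (\<lambda>k r. (k # r # xs) ! 0) (F xs))"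
    by (intro total_recursive_rec_nat[where G = "\<lambda>ys. ys ! 0"] total_recursive_const
        total_recursive_nth assms) simp
  then show ?thesis
  proof (rule total_recursive_cong)
    show "rec_nat 0 (\<lambda>k r. (k # r # xs) ! 0) (F xs) = F xs - 1" for xs
      by (cases "F xs") auto
  qed
qed

lemma total_recursive_diff:
  assumes "total_recursive n F" "total_recursive n G"
  shows "total_recursive n (\<lambda>xs. F xs - G xs)"
proof -
  have "total_recursive n (\<lambda>xs. rec_nat (F xs) (\<lambda>k r. (k # r # xs) ! 1 - 1) (G xs))"
    by (intro total_recursive_rec_nat[where G = "\<lambda>ys. ys ! 1 - 1"] total_recursive_pred
        total_recursive_nth assms) simp
  moreover have "rec_nat a (\<lambda>k r. (k # r # xs) ! 1 - 1) b = a - b" for a b :: nat and xs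
    by (induction b) auto
  ultimately show ?thesis
    by simp
qed

lemma total_recursive_if_eq:
  assumes "total_recursive n A" "total_recursive n B" "total_recursive n F" "total_recursive n G"
  shows "total_recursive n (\<lambda>xs. if A xs = B xs then F xs else G xs)"
proof -
  \<comment> \<open>Equality is tested as the vanishing of both truncated differences.\<close>
  have "total_recursive n
      (\<lambda>xs. if A xs - B xs = 0 then (if B xs - A xs = 0 then F xs else G xs) else G xs)"
    by (intro total_recursive_if_zero total_recursive_diff assms)
  then show ?thesis
    by (rule total_recursive_cong) auto
qed

lemmas total_recursive_intros = total_recursive_nth total_recursive_Suc total_recursive_const
  total_recursive_pred total_recursive_if_eq

section \<open>Finite combinations of total recursive functions\<close>

lemma total_recursive_all_nonzero:
  assumes "\<And>F. F \<in> set Fs \<Longrightarrow> total_recursive n F"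
  shows "total_recursive n (\<lambda>xs. if \<forall>F\<in>set Fs. F xs \<noteq> 0 then 1 else 0)"
  using assms
proof (induction Fs)
  case (Cons F Fs)
  have "total_recursive n
      (\<lambda>xs. if F xs = 0 then 0 else if \<forall>F\<in>set Fs. F xs \<noteq> 0 then 1 else 0)"
    using Cons by (intro total_recursive_if_zero total_recursive_const) auto
  then show ?case
    by (rule total_recursive_cong) auto
qed (simp add: total_recursive_const)

text \<open>With \<open>0\<close> read as "no value yet", this merges finitely many searches into
  one that invents no values of its own.\<close>

lemma total_recursive_first_nonzero:
  assumes "finite J" "\<And>j. j \<in> J \<Longrightarrow> total_recursive n (V j)"
  shows "\<exists>F. total_recursive n F \<and> (\<forall>xs. (\<exists>j\<in>J. V j xs \<noteq> 0) \<longrightarrow> F xs \<noteq> 0) \<and>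
    (\<forall>xs. F xs \<noteq> 0 \<longrightarrow> (\<exists>j\<in>J. F xs = V j xs))"
  using assms
proof (induction J rule: finite_induct)
  case empty
  show ?case
    by (rule exI[of _ "\<lambda>_. 0"]) (simp add: total_recursive_const)
next
  case (insert j J)
  then obtain F where "total_recursive n F" "\<forall>xs. (\<exists>j\<in>J. V j xs \<noteq> 0) \<longrightarrow> F xs \<noteq> 0"
    "\<forall>xs. F xs \<noteq> 0 \<longrightarrow> (\<exists>j\<in>J. F xs = V j xs)"
    by auto
  then show ?case
    using insert.prems
    by (intro exI[of _ "\<lambda>xs. if V j xs = 0 then F xs else V j xs"])
      (auto intro!: total_recursive_if_zero)
qed

text \<open>Agreement is built up one index at a time: a disagreement becomes \<open>0\<close>,
  which is no successor. For empty \<open>J\<close> every \<open>v\<close> would satisfy the right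
  side, and no \<open>F\<close> could exist.\<close>

lemma total_recursive_common_value:
  assumes "finite J" "J \<noteq> {}" "\<And>j. j \<in> J \<Longrightarrow> total_recursive n (V j)"
  shows "\<exists>F. total_recursive n F \<and> (\<forall>xs v. F xs = Suc v \<longleftrightarrow> (\<forall>j\<in>J. V j xs = Suc v))"
  using assms
proof (induction J rule: finite_ne_induct)
  case (singleton j)
  then show ?case
    by (intro exI[of _ "V j"]) simp
next
  case (insert j J)
  then obtain F where "total_recursive n F" "\<forall>xs v. F xs = Suc v \<longleftrightarrow> (\<forall>j\<in>J. V j xs = Suc v)"
    by auto
  then show ?case
    using insert.prems
    by (intro exI[of _ "\<lambda>xs. if V j xs = F xs then F xs else 0"])
      (auto intro!: total_recursive_if_eq total_recursive_const, metis+)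
qed

section \<open>Approximation in stages\<close>

text \<open>
  \<open>F (s # xs)\<close> is \<open>Suc v\<close> if the computation of \<open>f xs\<close> has returned \<open>v\<close> by stage \<open>s\<close>, and \<open>0\<close> if it
  is still running.
\<close>

definition approximates :: "nat \<Rightarrow> (nat list \<Rightarrow> nat) \<Rightarrow> (nat list \<rightharpoonup> nat) \<Rightarrow> bool" where
  "approximates n F f \<longleftrightarrow> total_recursive (Suc n) F \<and>
     (\<forall>xs s t v. length xs = n \<longrightarrow> s \<le> t \<longrightarrow> F (s # xs) = Suc v \<longrightarrow> F (t # xs) = Suc v) \<and>
     (\<forall>xs v. length xs = n \<longrightarrow> (f xs = Some v \<longleftrightarrow> (\<exists>s. F (s # xs) = Suc v)))"

lemma approximatesI:
  assumes "total_recursive (Suc n) F"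
    "\<And>xs s t v. length xs = n \<Longrightarrow> s \<le> t \<Longrightarrow> F (s # xs) = Suc v \<Longrightarrow> F (t # xs) = Suc v"
    "\<And>xs v. length xs = n \<Longrightarrow> f xs = Some v \<longleftrightarrow> (\<exists>s. F (s # xs) = Suc v)"
  shows "approximates n F f"
  using assms unfolding approximates_def by blast

lemma approximates_mono:
  assumes "approximates n F f" "length xs = n" "s \<le> t" "F (s # xs) = Suc v"
  shows "F (t # xs) = Suc v"
  using assms unfolding approximates_def by blast

lemma approximates_iff:
  assumes "approximates n F f" "length xs = n"
  shows "f xs = Some v \<longleftrightarrow> (\<exists>s. F (s # xs) = Suc v)"
  using assms unfolding approximates_def by blast

lemma approximates_total_recursive: "approximates n F f \<Longrightarrow> total_recursive (Suc n) F"
  unfolding approximates_def by blast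

text \<open>A total function may return its value already at stage \<open>0\<close>.\<close>

lemma approximates_total_map:
  assumes "total_recursive n F"
  shows "approximates n (\<lambda>ys. Suc (F (tl ys))) (total_map n F)"
proof (rule approximatesI)
  show "total_recursive (Suc n) (\<lambda>ys. Suc (F (tl ys)))"
    using total_recursive_drop[OF assms, of 1] by (simp add: total_recursive_Suc drop_Suc)
qed (auto simp: total_map_def tuples_def)

text \<open>The maximum of the individual stages works, since each property persists.\<close>

lemma stage_common:
  fixes P :: "'a \<Rightarrow> nat \<Rightarrow> bool"
  assumes "finite J" "\<And>j s t. j \<in> J \<Longrightarrow> s \<le> t \<Longrightarrow> P j s \<Longrightarrow> P j t" "\<And>j. j \<in> J \<Longrightarrow> \<exists>s. P j s"
  shows "\<exists>s. \<forall>j\<in>J. P j s"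
proof -
  obtain r where "\<And>j. j \<in> J \<Longrightarrow> P j (r j)"
    using assms(3) by metis
  moreover have "r j \<le> Max (r ` J)" if "j \<in> J" for j
    using that assms(1) by simp
  ultimately show ?thesis
    using assms(2) by blast
qed

section \<open>Closure of approximations under the schemes of partial recursion\<close>

lemma approximates_comp:
  assumes G: "approximates (length fs) G g"
    and \<Phi>: "\<And>f. f \<in> set fs \<Longrightarrow> approximates n (\<Phi> f) f"
  shows "\<exists>F. approximates n F (comp_fun n g fs)"
proof -
  \<comment> \<open>Entry \<open>0\<close> of \<open>ys\<close> is the stage, shared by all
    computations. An unfinished inner computation gives \<open>0\<close>; otherwise
    \<open>- 1\<close> strips the successor from the inner values before they enter
    \<open>G\<close>.\<close>
  define F where "F ys = (if (if \<forall>H\<in>set (map \<Phi> fs). H ys \<noteq> 0 then 1 else 0) = (0::nat) then 0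
    else G (map (\<lambda>H. H ys) ((\<lambda>ys. ys ! 0) # map (\<lambda>f ys. \<Phi> f ys - 1) fs)))" for ys
  have F_eq: "F (s # xs) = Suc v \<longleftrightarrow>
      (\<forall>f\<in>set fs. \<Phi> f (s # xs) \<noteq> 0) \<and> G (s # map (\<lambda>f. \<Phi> f (s # xs) - 1) fs) = Suc v" for s xs v
    by (auto simp: F_def comp_def)
  have \<Phi>_mono: "\<Phi> f (t # xs) = \<Phi> f (s # xs)"
    if "length xs = n" "f \<in> set fs" "s \<le> t" "\<Phi> f (s # xs) \<noteq> 0" for f s t xs
    using approximates_mono[OF \<Phi>[OF that(2)] that(1) that(3)] that(4) not0_implies_Suc by metis
  have "approximates n F (comp_fun n g fs)"
  proof (rule approximatesI)
    show "total_recursive (Suc n) F"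
      unfolding F_def
    proof (intro total_recursive_if_zero total_recursive_all_nonzero total_recursive_const
        total_recursive_comp)
      show "total_recursive (length ((\<lambda>ys. ys ! 0) # map (\<lambda>f ys. \<Phi> f ys - 1) fs)) G"
        using approximates_total_recursive[OF G] by simp
    next
      fix H assume "H \<in> set ((\<lambda>ys. ys ! 0) # map (\<lambda>f ys. \<Phi> f ys - 1) fs)"
      then show "total_recursive (Suc n) H"
        using \<Phi> approximates_total_recursive
        by (auto intro!: total_recursive_nth total_recursive_pred simp del: One_nat_def)
    qed (use \<Phi> approximates_total_recursive in auto)
  next
    fix xs :: "nat list" and s t v
    assume *: "length xs = n" "s \<le> t" "F (s # xs) = Suc v"
    then have "map (\<lambda>f. \<Phi> f (t # xs) - 1) fs = map (\<lambda>f. \<Phi> f (s # xs) - 1) fs"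
      using \<Phi>_mono by (auto simp: F_eq)
    moreover have "\<Phi> f (t # xs) \<noteq> 0" if "f \<in> set fs" for f
      using * \<Phi>_mono that by (auto simp: F_eq)
    moreover have "G (t # map (\<lambda>f. \<Phi> f (s # xs) - 1) fs) = Suc v"
      using * by (intro approximates_mono[OF G _ \<open>s \<le> t\<close>]) (auto simp: F_eq)
    ultimately show "F (t # xs) = Suc v"
      unfolding F_eq by metis
  next
    fix xs :: "nat list" and v
    assume len: "length xs = n"
    have val: "\<Phi> f (s # xs) - 1 = the (f xs)" "xs \<in> dom f"
      if "f \<in> set fs" "\<Phi> f (s # xs) \<noteq> 0" for f s
    proof -
      have "f xs = Some (\<Phi> f (s # xs) - 1)"
        unfolding approximates_iff[OF \<Phi>[OF that(1)] len] using that(2) by (intro exI[of _ s]) simp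
      then show "\<Phi> f (s # xs) - 1 = the (f xs)" "xs \<in> dom f"
        by auto
    qed
    show "comp_fun n g fs xs = Some v \<longleftrightarrow> (\<exists>s. F (s # xs) = Suc v)"
    proof
      assume *: "comp_fun n g fs xs = Some v"
      then have dom: "\<forall>f\<in>set fs. xs \<in> dom f" and "g (map (\<lambda>f. the (f xs)) fs) = Some v"
        by (auto simp: comp_fun_def restrict_map_def split: if_splits)
      then obtain s where s: "G (s # map (\<lambda>f. the (f xs)) fs) = Suc v"
        using approximates_iff[OF G, of "map (\<lambda>f. the (f xs)) fs" v] by auto
      have "\<exists>s. \<forall>f\<in>set fs. \<Phi> f (s # xs) \<noteq> 0"
      proof (rule stage_common)
        show "\<exists>s. \<Phi> f (s # xs) \<noteq> 0" if f: "f \<in> set fs" for f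
        proof -
          obtain u where "f xs = Some u"
            using dom f by blast
          then obtain s where "\<Phi> f (s # xs) = Suc u"
            using approximates_iff[OF \<Phi>[OF f] len] by blast
          then show ?thesis
            by (intro exI[of _ s]) simp
        qed
        show "\<Phi> f (t # xs) \<noteq> 0" if "f \<in> set fs" "s \<le> t" "\<Phi> f (s # xs) \<noteq> 0" for f s t
          using \<Phi>_mono[OF len that] that(3) by simp
      qed simp
      then obtain t where t: "\<forall>f\<in>set fs. \<Phi> f (t # xs) \<noteq> 0"
        by blast
      \<comment> \<open>\<open>s\<close> suffices for the outer computation and \<open>t\<close> for
        all inner ones; monotonicity carries both to the maximum.\<close>
      define m where "m = max s t"
      have m: "\<forall>f\<in>set fs. \<Phi> f (m # xs) \<noteq> 0"
        using t \<Phi>_mono[OF len, of _ t m] by (auto simp: m_def)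
      moreover have "map (\<lambda>f. \<Phi> f (m # xs) - 1) fs = map (\<lambda>f. the (f xs)) fs"
        using val(1) m by simp
      moreover have "G (m # map (\<lambda>f. the (f xs)) fs) = Suc v"
        using approximates_mono[OF G _ _ s, of m] by (simp add: m_def)
      ultimately show "\<exists>s. F (s # xs) = Suc v"
        unfolding F_eq by metis
    next
      assume "\<exists>s. F (s # xs) = Suc v"
      then obtain s where s: "\<forall>f\<in>set fs. \<Phi> f (s # xs) \<noteq> 0"
        "G (s # map (\<lambda>f. \<Phi> f (s # xs) - 1) fs) = Suc v"
        by (auto simp: F_eq)
      have "map (\<lambda>f. \<Phi> f (s # xs) - 1) fs = map (\<lambda>f. the (f xs)) fs"
        using val(1) s(1) by simp
      then have "G (s # map (\<lambda>f. the (f xs)) fs) = Suc v"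
        using s(2) by (simp only:)
      then have "g (map (\<lambda>f. the (f xs)) fs) = Some v"
        using approximates_iff[OF G, of "map (\<lambda>f. the (f xs)) fs" v] by auto
      moreover have "\<forall>f\<in>set fs. xs \<in> dom f"
        using val(2) s(1) by blast
      ultimately show "comp_fun n g fs xs = Some v"
        using len by (simp add: comp_fun_def tuples_def)
    qed
  qed
  then show ?thesis
    by blast
qed

lemma approximates_prim_rec:
  assumes F: "approximates n F f" and G: "approximates (n + 2) G g"
  shows "\<exists>R. approximates (Suc n) R (prim_rec_fun f g)"
proof -
  \<comment> \<open>One stage \<open>s\<close> serves every call. A value \<open>0\<close>, meaning
    unfinished, is passed on through all later steps.\<close>
  define Q where "Q s xs = rec_nat (F (s # xs))
    (\<lambda>k r. if r = 0 then 0 else G (s # k # (r - 1) # xs))" for s xs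
  have Q_Suc: "Q s xs (Suc k) = Suc v \<longleftrightarrow>
      (\<exists>r. Q s xs k = Suc r \<and> G (s # k # r # xs) = Suc v)" for s xs k v
    by (cases "Q s xs k") (auto simp: Q_def)
  have Q_0: "Q s xs 0 = F (s # xs)" for s xs
    by (simp add: Q_def)
  have Q_mono: "Q t xs k = Suc v" if "length xs = n" "s \<le> t" "Q s xs k = Suc v" for s t xs k v
    using that(3)
  proof (induction k arbitrary: v)
    case 0
    then show ?case
      using approximates_mono[OF F that(1,2)] by (simp add: Q_0)
  next
    case (Suc k)
    then show ?case
      using approximates_mono[OF G _ that(2)] that(1) by (fastforce simp: Q_Suc)
  qed
  have Q_iff: "prim_rec f g xs k = Some v \<longleftrightarrow> (\<exists>s. Q s xs k = Suc v)" if "length xs = n" for xs k v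
  proof (induction k arbitrary: v)
    case 0
    then show ?case
      using approximates_iff[OF F that] by (simp add: Q_0)
  next
    case (Suc k)
    have "prim_rec f g xs (Suc k) = Some v \<longleftrightarrow>
        (\<exists>r s t. Q s xs k = Suc r \<and> G (t # k # r # xs) = Suc v)"
      using Suc approximates_iff[OF G, of "k # _ # xs"] that by (auto simp: bind_eq_Some_conv)
    also have "\<dots> \<longleftrightarrow> (\<exists>r s. Q s xs k = Suc r \<and> G (s # k # r # xs) = Suc v)"
    proof -
      \<comment> \<open>By monotonicity, the separate stages of the two computations merge into
        their maximum.\<close>
      have "Q (max s t) xs k = Suc r \<and> G (max s t # k # r # xs) = Suc v"
        if "Q s xs k = Suc r" "G (t # k # r # xs) = Suc v" for r s t
        using that \<open>length xs = n\<close> Q_mono[of xs s "max s t" k r]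
          approximates_mono[OF G, of "k # r # xs" t "max s t" v] by simp
      then show ?thesis
        by blast
    qed
    finally show ?case
      by (auto simp: Q_Suc)
  qed
  define R where "R ys = Q (ys ! 0) (drop 2 ys) (ys ! 1)" for ys
  have "approximates (Suc n) R (prim_rec_fun f g)"
  proof (rule approximatesI)
    \<comment> \<open>The recursion runs over \<open>ys = s # c # xs\<close> with depth
      \<open>c\<close>, so its step function reads \<open>k # r # s # c # xs\<close>. Both
      \<open>drop 2\<close> and \<open>drop 4\<close> discard \<open>c\<close> along with the
      entries before it.\<close>
    define F' where "F' zs = F (map (\<lambda>H. H zs) [\<lambda>zs. zs ! 0] @ drop 2 zs)" for zs
    define G' where "G' zs = (if zs ! 1 = 0 then 0 else
      G (map (\<lambda>H. H zs) [\<lambda>zs. zs ! 2, \<lambda>zs. zs ! 0, \<lambda>zs. zs ! 1 - 1] @ drop 4 zs))" for zs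
    have "total_recursive (Suc (Suc n)) F'"
      unfolding F'_def using approximates_total_recursive[OF F]
      by (rule total_recursive_subst) (auto intro: total_recursive_intros)
    moreover have "total_recursive (Suc (Suc n) + 2) G'"
      unfolding G'_def
      by (intro total_recursive_if_zero total_recursive_intros
          total_recursive_subst[OF approximates_total_recursive[OF G]])
        (auto intro!: total_recursive_intros simp del: One_nat_def)
    ultimately have "total_recursive (Suc (Suc n))
        (\<lambda>ys. rec_nat (F' ys) (\<lambda>k r. G' (k # r # ys)) (ys ! 1))"
      by (intro total_recursive_rec_nat total_recursive_nth) auto
    then show "total_recursive (Suc (Suc n)) R"
    proof (rule total_recursive_cong)
      fix ys :: "nat list"
      assume "length ys = Suc (Suc n)"
      then show "rec_nat (F' ys) (\<lambda>k r. G' (k # r # ys)) (ys ! 1) = R ys"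
        by (simp add: R_def Q_def F'_def G'_def cong: if_cong)
    qed
  next
    fix xs :: "nat list" and s t v
    assume "length xs = Suc n" "s \<le> t" "R (s # xs) = Suc v"
    then show "R (t # xs) = Suc v"
      using Q_mono by (auto simp: R_def length_Suc_conv)
  next
    fix xs :: "nat list" and v
    assume "length xs = Suc n"
    then show "prim_rec_fun f g xs = Some v \<longleftrightarrow> (\<exists>s. R (s # xs) = Suc v)"
      using Q_iff by (auto simp: R_def prim_rec_fun_def length_Suc_conv)
  qed
  then show ?thesis
    by blast
qed

text \<open>By minimality, the defined values below the result are nonzero. This form replaces
  \<open>LEAST\<close> by finitely many conditions, each settled at some stage.\<close>

lemma mu_fun_eq_Some_iff:
  "mu_fun f xs = Some y \<longleftrightarrow> f (y # xs) = Some 0 \<and> (\<forall>z<y. \<exists>w. f (z # xs) = Some (Suc w))"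
proof
  assume "mu_fun f xs = Some y"
  then obtain y' where y': "f (y' # xs) = Some 0" "\<forall>z<y'. (z # xs) \<in> dom f"
    and y: "y = (LEAST y. f (y # xs) = Some 0)"
    by (auto simp: mu_fun_def split: if_splits)
  have "f (y # xs) = Some 0" "y \<le> y'"
    unfolding y using y'(1) by (auto intro: LeastI Least_le)
  moreover have "\<exists>w. f (z # xs) = Some (Suc w)" if "z < y" for z
  proof -
    have "f (z # xs) \<noteq> Some 0"
      using that not_less_Least unfolding y by blast
    moreover have "z # xs \<in> dom f"
      using that y'(2) \<open>y \<le> y'\<close> by auto
    ultimately show ?thesis
      using not0_implies_Suc by (metis domD)
  qed
  ultimately show "f (y # xs) = Some 0 \<and> (\<forall>z<y. \<exists>w. f (z # xs) = Some (Suc w))"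
    by blast
next
  assume *: "f (y # xs) = Some 0 \<and> (\<forall>z<y. \<exists>w. f (z # xs) = Some (Suc w))"
  then have "(LEAST y. f (y # xs) = Some 0) = y"
    by (intro Least_equality) (auto simp: not_less[symmetric])
  moreover have "\<exists>y. f (y # xs) = Some 0 \<and> (\<forall>z<y. (z # xs) \<in> dom f)"
    using * by (intro exI[of _ y]) auto
  ultimately show "mu_fun f xs = Some y"
    unfolding mu_fun_def by simp
qed

lemma approximates_mu:
  assumes F: "approximates (Suc n) F f"
  shows "\<exists>M. approximates n M (mu_fun f)"
proof -
  txt \<open>
    In the bounded search, \<open>0\<close> means that all values so far are nonzero, \<open>1\<close> that a value is
    still undefined at stage \<open>s\<close>, and \<open>y + 2\<close> that \<open>y\<close> is the result.
  \<close>
  define B where "B s xs = rec_nat 0 (\<lambda>k r. if r = 0 then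
      if F (s # k # xs) = 0 then 1 else if F (s # k # xs) = 1 then Suc (Suc k) else 0
    else r)" for s xs
  have B: "(B s xs k = 0 \<longleftrightarrow> (\<forall>z<k. \<exists>w. F (s # z # xs) = Suc (Suc w))) \<and>
    (B s xs k = Suc (Suc y) \<longleftrightarrow>
      y < k \<and> F (s # y # xs) = 1 \<and> (\<forall>z<y. \<exists>w. F (s # z # xs) = Suc (Suc w)))" for s xs k y
  proof (induction k)
    case 0
    show ?case
      by (simp add: B_def)
  next
    case (Suc k)
    have step: "B s xs (Suc k) = (if B s xs k = 0 then
        if F (s # k # xs) = 0 then 1 else if F (s # k # xs) = 1 then Suc (Suc k) else 0
      else B s xs k)"
      by (simp add: B_def)
    consider "F (s # k # xs) = 0" | "F (s # k # xs) = 1" | w where "F (s # k # xs) = Suc (Suc w)"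
      by (metis One_nat_def not0_implies_Suc)
    then show ?case
      using Suc unfolding step by cases (auto simp: less_Suc_eq)
  qed
  \<comment> \<open>The stage also bounds the search. Subtracting \<open>1\<close> merges the codes
    \<open>0\<close> and \<open>1\<close> into \<open>0\<close>, no result so far, and turns
    \<open>y + 2\<close> into \<open>Suc y\<close>.\<close>
  define M where "M ys = B (ys ! 0) (drop 1 ys) (ys ! 0) - 1" for ys
  have M: "M (s # xs) = Suc y \<longleftrightarrow>
    y < s \<and> F (s # y # xs) = 1 \<and> (\<forall>z<y. \<exists>w. F (s # z # xs) = Suc (Suc w))" for s xs y
  proof -
    have "M (s # xs) = Suc y \<longleftrightarrow> B s xs s = Suc (Suc y)"
      by (auto simp: M_def)
    then show ?thesis
      using B by simp
  qed
  have "approximates n M (mu_fun f)"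
  proof (rule approximatesI)
    \<comment> \<open>The step function reads \<open>k # r # s # xs\<close>, so \<open>G\<close>
      computes \<open>F (s # k # xs)\<close>.\<close>
    define G where "G zs = F (map (\<lambda>H. H zs) [\<lambda>zs. zs ! 2, \<lambda>zs. zs ! 0] @ drop 3 zs)" for zs
    define G' where "G' zs = (if zs ! 1 = 0 then
        if G zs = 0 then 1 else if G zs = 1 then Suc (Suc (zs ! 0)) else 0
      else zs ! 1)" for zs
    have "total_recursive (Suc n + 2) G"
      unfolding G_def using approximates_total_recursive[OF F]
      by (rule total_recursive_subst) (auto intro: total_recursive_intros)
    then have "total_recursive (Suc n + 2) G'"
      unfolding G'_def by (intro total_recursive_intros) auto
    then have "total_recursive (Suc n)
        (\<lambda>ys. rec_nat 0 (\<lambda>k r. G' (k # r # ys)) (ys ! 0) - 1)"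
      by (intro total_recursive_pred total_recursive_rec_nat total_recursive_intros) auto
    then show "total_recursive (Suc n) M"
    proof (rule total_recursive_cong)
      fix ys :: "nat list"
      assume "length ys = Suc n"
      then show "rec_nat 0 (\<lambda>k r. G' (k # r # ys)) (ys ! 0) - 1 = M ys"
        by (simp add: M_def B_def G'_def G_def cong: if_cong)
    qed
  next
    fix xs :: "nat list" and s t v
    assume len: "length xs = n" and "s \<le> t" and Ms: "M (s # xs) = Suc v"
    have mono: "F (t # z # xs) = Suc w" if "F (s # z # xs) = Suc w" for z w
      using approximates_mono[OF F _ \<open>s \<le> t\<close> that] len by simp
    show "M (t # xs) = Suc v"
      using Ms \<open>s \<le> t\<close> mono unfolding M by (metis One_nat_def less_le_trans)
  next
    fix xs :: "nat list" and v
    assume len: "length xs = n"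
    have f: "f (z # xs) = Some w \<longleftrightarrow> (\<exists>s. F (s # z # xs) = Suc w)" for z w
      using approximates_iff[OF F] len by simp
    have mono: "F (t # z # xs) = Suc w" if "F (s # z # xs) = Suc w" "s \<le> t" for s t z w
      using approximates_mono[OF F _ that(2,1)] len by simp
    show "mu_fun f xs = Some v \<longleftrightarrow> (\<exists>s. M (s # xs) = Suc v)"
    proof
      assume *: "mu_fun f xs = Some v"
      then obtain s where s: "F (s # v # xs) = Suc 0"
        by (auto simp: mu_fun_eq_Some_iff f)
      have "\<exists>s. \<forall>z\<in>{..<v}. \<exists>w. F (s # z # xs) = Suc (Suc w)"
      proof (rule stage_common)
        show "\<exists>s w. F (s # z # xs) = Suc (Suc w)" if "z \<in> {..<v}" for z
          using * that unfolding mu_fun_eq_Some_iff f by blast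
      qed (use mono in blast)+
      then obtain t where t: "\<forall>z<v. \<exists>w. F (t # z # xs) = Suc (Suc w)"
        by auto
      \<comment> \<open>The stage must exceed \<open>v\<close>, because it bounds the search, and be
        at least \<open>s\<close> for the zero at \<open>v\<close> and \<open>t\<close> for the
        values below it.\<close>
      have "M ((s + t + Suc v) # xs) = Suc v"
        unfolding M
      proof (intro conjI allI impI)
        show "F ((s + t + Suc v) # v # xs) = 1"
          using mono[OF s, of "s + t + Suc v"] by simp
        show "\<exists>w. F ((s + t + Suc v) # z # xs) = Suc (Suc w)" if "z < v" for z
          using t that mono[of t z _ "s + t + Suc v"] by fastforce
      qed simp
      then show "\<exists>s. M (s # xs) = Suc v" ..
    next
      assume "\<exists>s. M (s # xs) = Suc v"
      then show "mu_fun f xs = Some v"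
        unfolding M mu_fun_eq_Some_iff f by (metis One_nat_def)
    qed
  qed
  then show ?thesis
    by blast
qed

text \<open>Each scheme preserves approximability. The gain is that several possibly diverging
  computations can be run in parallel by one search over stages.\<close>

theorem partial_recursive_approximates:
  "partial_recursive n f \<Longrightarrow> \<exists>F. approximates n F f"
proof (induction rule: partial_recursive.induct)
  case (zero n)
  have "zero_fun n = total_map n (\<lambda>_. 0)"
    by (simp add: zero_fun_def total_map_def)
  then show ?case
    using approximates_total_map[OF total_recursive_const] by metis
next
  case succ
  have "succ_fun = total_map 1 (\<lambda>xs. Suc (hd xs))"
    by (simp add: succ_fun_def total_map_def)
  then show ?case
    using approximates_total_map partial_recursive.succ total_recursive_def by metis
next
  case (proj i n)
  have "proj_fun n i = total_map n (\<lambda>xs. xs ! i)"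
    by (simp add: proj_fun_def total_map_def)
  then show ?case
    using approximates_total_map[OF total_recursive_nth[OF proj]] by metis
next
  case (comp fs g n)
  then obtain G where "approximates (length fs) G g"
    by blast
  moreover obtain \<Phi> where "\<And>f. f \<in> set fs \<Longrightarrow> approximates n (\<Phi> f) f"
    using comp.IH by metis
  ultimately show ?case
    by (rule approximates_comp)
next
  case (prim_rec n f g)
  then show ?case
    using approximates_prim_rec by fastforce
next
  case (mu n f)
  then show ?case
    using approximates_mu by fastforce
qed

section \<open>Unbounded search and recursively enumerable fibers\<close>

text \<open>Minimization finds the first stage with a nonzero value, and \<open>F\<close> is
  evaluated there. As \<open>F\<close> may vary with the stage, only a value taken at some stage is
  promised.\<close>

lemma partial_recursive_search:
  assumes F: "total_recursive (Suc n) F"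
  shows "\<exists>h. partial_recursive n h \<and>
    (\<forall>xs s. length xs = n \<longrightarrow> F (s # xs) \<noteq> 0 \<longrightarrow> (\<exists>v t. h xs = Some v \<and> F (t # xs) = Suc v))"
proof -
  \<comment> \<open>Minimization looks for zeros, so zero and nonzero are swapped.\<close>
  define m where "m = mu_fun (total_map (n + 1) (\<lambda>ys. if F ys = 0 then 1 else 0))"
  \<comment> \<open>These inner functions produce the list \<open>t # xs\<close>, with
    \<open>t\<close> the stage found.\<close>
  define fs where "fs = m # map (proj_fun n) [0..<n]"
  define h where "h = comp_fun n (total_map (Suc n) (\<lambda>ys. F ys - 1)) fs"
  have m_rec: "partial_recursive n m"
    using total_recursive_if_zero[OF F total_recursive_const total_recursive_const]
    unfolding m_def by (intro partial_recursive.mu) (simp add: total_recursive_def)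
  have "partial_recursive n h"
    unfolding h_def
  proof (rule partial_recursive.comp)
    show "partial_recursive (length fs) (total_map (Suc n) (\<lambda>ys. F ys - 1))"
      using total_recursive_pred[OF F] by (simp add: fs_def total_recursive_def)
    show "\<forall>f\<in>set fs. partial_recursive n f"
      using m_rec by (auto simp: fs_def intro: partial_recursive.proj)
  qed
  moreover have "\<exists>v t. h xs = Some v \<and> F (t # xs) = Suc v"
    if len: "length xs = n" and s: "F (s # xs) \<noteq> 0" for xs s
  proof -
    define t where "t = (LEAST t. F (t # xs) \<noteq> 0)"
    have "F (t # xs) \<noteq> 0"
      unfolding t_def using s by (rule LeastI)
    moreover have "F (z # xs) = 0" if "z < t" for z
      using not_less_Least that unfolding t_def by blast
    ultimately have t: "m xs = Some t"
      using len by (simp add: m_def mu_fun_eq_Some_iff total_map_apply tuples_def)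
    have "map (\<lambda>f. the (f xs)) fs = t # xs"
      using len t by (auto simp: fs_def proj_fun_def tuples_def comp_def intro: nth_equalityI)
    moreover have "xs \<in> dom f" if "f \<in> set fs" for f
      using that t len by (auto simp: fs_def proj_fun_def tuples_def)
    ultimately have "h xs = Some (F (t # xs) - 1)"
      using len by (simp add: h_def comp_fun_def tuples_def total_map_apply)
    then show ?thesis
      using \<open>F (t # xs) \<noteq> 0\<close> by (intro exI[of _ "F (t # xs) - 1"] exI[of _ t]) simp
  qed
  ultimately show ?thesis
    by blast
qed

lemma recursively_enumerable_fiber:
  assumes "partial_recursive n g"
  shows "recursively_enumerable n {xs. g xs = Some c}"
proof -
  \<comment> \<open>On \<open>[a]\<close> the minimized function does not depend on the search
    variable: the search stops at \<open>0\<close> if \<open>a = c\<close> and never otherwise.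
    Composing with \<open>g\<close> leaves the fiber as domain.\<close>
  define p where "p = mu_fun (total_map (1 + 1) (\<lambda>ys. if ys ! 1 = c then 0 else 1))"
  have "partial_recursive 1 p"
    unfolding p_def
    by (intro partial_recursive.mu)
      (auto simp flip: total_recursive_def intro!: total_recursive_intros simp del: One_nat_def)
  then have "partial_recursive n (comp_fun n p [g])"
    using assms by (intro partial_recursive.comp) auto
  moreover have "p [a] \<noteq> None \<longleftrightarrow> a = c" for a
    by (auto simp: p_def mu_fun_eq_Some_iff total_map_apply tuples_def split: if_splits)
  then have "dom (comp_fun n p [g]) = {xs. g xs = Some c}"
    using partial_recursive_dom[OF assms]
    by (auto simp: comp_fun_def restrict_map_def dom_def split: if_splits)
  ultimately show ?thesis
    unfolding recursively_enumerable_def by metis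
qed

section \<open>Joins\<close>

lemma separation_if_strongly_join_permitting:
  assumes sub: "\<And>i. i \<in> I \<Longrightarrow> A i \<subseteq> tuples n"
    and join: "strongly_join_permitting {f. potentially_partial_recursive n f} (A ` I)"
    and K: "K \<subseteq> I"
  shows "\<exists>H. recursively_enumerable n H \<and>
    separates H ((\<Union>i\<in>K. A i) - (\<Union>i\<in>I - K. A i)) ((\<Union>i\<in>I - K. A i) - (\<Union>i\<in>K. A i))"
proof -
  define P where "P = (\<Union>i\<in>K. A i) - (\<Union>i\<in>I - K. A i)"
  define Q where "Q = (\<Union>i\<in>I - K. A i) - (\<Union>i\<in>K. A i)"
  \<comment> \<open>At points covered both by a set from \<open>K\<close> and by one from
    \<open>I - K\<close>, \<open>f\<close> stays undefined.\<close>
  define f where "f xs = (if xs \<in> P then Some 1 else if xs \<in> Q then Some (0::nat) else None)" for xs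
  have const: "potentially_partial_recursive n (total_map n (\<lambda>_. c) |` D)" for c D
    using total_recursive_const
    unfolding potentially_partial_recursive_def total_recursive_def by blast
  have "potentially_partial_recursive n (f |` A i)" if "i \<in> I" for i
  proof -
    \<comment> \<open>For \<open>i \<in> K\<close> the set \<open>A i\<close> misses
      \<open>Q\<close>, and for \<open>i \<in> I - K\<close> it misses \<open>P\<close>.\<close>
    have "f |` A i = total_map n (\<lambda>_. if i \<in> K then 1 else 0) |` (A i \<inter> (P \<union> Q))"
      using sub[OF that] that
      by (intro ext) (auto simp: f_def P_def Q_def restrict_map_def total_map_def split: if_splits)
    then show ?thesis
      using const by simp
  qed
  moreover have "dom f \<subseteq> \<Union>(A ` I)"
    using K by (fastforce simp: f_def P_def Q_def split: if_splits)
  ultimately have "potentially_partial_recursive n f"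
    using join unfolding strongly_join_permitting_def by blast
  then obtain g D where g: "partial_recursive n g" and f: "f = g |` D"
    unfolding potentially_partial_recursive_def by blast
  have ext: "g xs = Some v" if "f xs = Some v" for xs v
    using that unfolding f by (auto simp: restrict_map_def split: if_splits)
  have "separates {xs. g xs = Some 1} P Q"
    unfolding separates_def
  proof
    show "P \<subseteq> {xs. g xs = Some 1}"
      using ext by (auto simp: f_def)
    have "g xs = Some 0" if "xs \<in> Q" for xs
      using that ext by (auto simp: f_def P_def Q_def)
    then show "{xs. g xs = Some 1} \<inter> Q = {}"
      by auto
  qed
  then show ?thesis
    using recursively_enumerable_fiber[OF g] unfolding P_def Q_def by blast
qed

lemma strongly_join_permitting_if_separation:
  assumes fin: "finite I"
    and sub: "\<And>i. i \<in> I \<Longrightarrow> A i \<subseteq> tuples n"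
    and sep: "\<And>K. K \<subseteq> I \<Longrightarrow> \<exists>H. recursively_enumerable n H \<and>
      separates H ((\<Union>i\<in>K. A i) - (\<Union>i\<in>I - K. A i)) ((\<Union>i\<in>I - K. A i) - (\<Union>i\<in>K. A i))"
  shows "strongly_join_permitting {f. potentially_partial_recursive n f} (A ` I)"
  unfolding strongly_join_permitting_def
proof (intro allI impI CollectI)
  fix f
  assume dom: "dom f \<subseteq> \<Union>(A ` I)"
    and loc: "\<forall>B\<in>A ` I. f |` B \<in> {f. potentially_partial_recursive n f}"
  have "\<exists>G g. approximates n G g \<and> (\<forall>xs\<in>A i. \<forall>v. f xs = Some v \<longrightarrow> g xs = Some v)"
    if "i \<in> I" for i
  proof -
    have "potentially_partial_recursive n (f |` A i)"
      using loc that by simp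
    then obtain g D where g: "partial_recursive n g" "f |` A i = g |` D"
      unfolding potentially_partial_recursive_def by blast
    have "g xs = Some v" if "xs \<in> A i" "f xs = Some v" for xs v
      using fun_cong[OF g(2), of xs] that by (auto simp: restrict_map_def split: if_splits)
    then show ?thesis
      using partial_recursive_approximates[OF g(1)] by blast
  qed
  then obtain G g where G: "\<And>i. i \<in> I \<Longrightarrow> approximates n (G i) (g i)"
    and g: "\<And>i xs v. i \<in> I \<Longrightarrow> xs \<in> A i \<Longrightarrow> f xs = Some v \<Longrightarrow> g i xs = Some v"
    by metis
  \<comment> \<open>The separating sets appear as domains, so only whether \<open>E K\<close> is
    nonzero will matter, not its value.\<close>
  have "\<exists>E e. approximates n E e \<and> separates (dom e)
      ((\<Union>i\<in>K. A i) - (\<Union>i\<in>I - K. A i)) ((\<Union>i\<in>I - K. A i) - (\<Union>i\<in>K. A i))" if "K \<subseteq> I" for K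
    using sep[OF that] partial_recursive_approximates unfolding recursively_enumerable_def by metis
  then obtain E e where E: "\<And>K. K \<subseteq> I \<Longrightarrow> approximates n (E K) (e K)"
    and e: "\<And>K. K \<subseteq> I \<Longrightarrow> separates (dom (e K))
      ((\<Union>i\<in>K. A i) - (\<Union>i\<in>I - K. A i)) ((\<Union>i\<in>I - K. A i) - (\<Union>i\<in>K. A i))"
    by metis
  \<comment> \<open>The empty set is left out because its demand for a common value would be vacuous
    and determine nothing.\<close>
  define \<K> where "\<K> = {K. K \<subseteq> I \<and> K \<noteq> {}}"
  have "\<exists>V. total_recursive (Suc n) V \<and>
      (\<forall>ys v. V ys = Suc v \<longleftrightarrow> E K ys \<noteq> 0 \<and> (\<forall>i\<in>K. G i ys = Suc v))" if K: "K \<in> \<K>" for K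
  proof -
    have KI: "K \<subseteq> I" "K \<noteq> {}"
      using K by (auto simp: \<K>_def)
    then have "total_recursive (Suc n) (G i)" if "i \<in> K" for i
      using that G approximates_total_recursive by blast
    then obtain V where "total_recursive (Suc n) V"
      "\<forall>ys v. V ys = Suc v \<longleftrightarrow> (\<forall>i\<in>K. G i ys = Suc v)"
      using total_recursive_common_value[OF finite_subset[OF KI(1) fin] KI(2), of "Suc n" G]
      by blast
    then show ?thesis
      using KI approximates_total_recursive[OF E]
      by (intro exI[of _ "\<lambda>ys. if E K ys = 0 then 0 else V ys"])
        (auto intro!: total_recursive_if_zero total_recursive_const)
  qed
  then have "\<exists>V. \<forall>K\<in>\<K>. total_recursive (Suc n) (V K) \<and>
      (\<forall>ys v. V K ys = Suc v \<longleftrightarrow> E K ys \<noteq> 0 \<and> (\<forall>i\<in>K. G i ys = Suc v))"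
    by (intro bchoice ballI)
  then obtain V where V': "\<forall>K\<in>\<K>. total_recursive (Suc n) (V K) \<and>
      (\<forall>ys v. V K ys = Suc v \<longleftrightarrow> E K ys \<noteq> 0 \<and> (\<forall>i\<in>K. G i ys = Suc v))"
    ..
  then have V: "V K ys = Suc v \<longleftrightarrow> E K ys \<noteq> 0 \<and> (\<forall>i\<in>K. G i ys = Suc v)"
    if "K \<in> \<K>" for K ys v
    using that by blast
  have "finite \<K>"
    unfolding \<K>_def using fin by simp
  then obtain F where F_rec: "total_recursive (Suc n) F"
    and F_nz: "\<forall>ys. (\<exists>K\<in>\<K>. V K ys \<noteq> 0) \<longrightarrow> F ys \<noteq> 0"
    and F_V: "\<forall>ys. F ys \<noteq> 0 \<longrightarrow> (\<exists>K\<in>\<K>. F ys = V K ys)"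
    using total_recursive_first_nonzero[of \<K> "Suc n" V] V' by auto
  obtain h where h_rec: "partial_recursive n h"
    and h: "\<And>xs s. length xs = n \<Longrightarrow> F (s # xs) \<noteq> 0 \<Longrightarrow> \<exists>v t. h xs = Some v \<and> F (t # xs) = Suc v"
    using partial_recursive_search[OF F_rec] by blast
  have ext: "h xs = Some v" if f: "f xs = Some v" for xs v
  proof -
    define S where "S = {i \<in> I. xs \<in> A i}"
    have S: "S \<in> \<K>" "S \<subseteq> I"
      using f dom by (auto simp: S_def \<K>_def)
    have len: "length xs = n"
      using f dom sub by (fastforce simp: tuples_def)
    have g_S: "g i xs = Some v" if "i \<in> S" for i
      using g f that unfolding S_def by blast
    have "\<exists>s. \<forall>i\<in>S. G i (s # xs) = Suc v"
    proof (rule stage_common)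
      show "finite S"
        using fin by (simp add: S_def)
      show "G i (t # xs) = Suc v" if "i \<in> S" "s \<le> t" "G i (s # xs) = Suc v" for i s t
        using approximates_mono[OF G len that(2,3)] that(1) by (simp add: S_def)
      show "\<exists>s. G i (s # xs) = Suc v" if "i \<in> S" for i
        using g_S[OF that] approximates_iff[OF G len] that S(2) by blast
    qed
    then obtain s where s: "\<forall>i\<in>S. G i (s # xs) = Suc v"
      by blast
    \<comment> \<open>\<open>xs\<close> lies in exactly those sets whose index is in the nonempty
      \<open>S\<close>, hence in the difference that \<open>dom (e S)\<close> contains.\<close>
    have "xs \<in> dom (e S)"
      using e[OF S(2)] S(1) unfolding separates_def S_def \<K>_def by auto
    then obtain w t where t: "E S (t # xs) = Suc w"
      using approximates_iff[OF E[OF S(2)] len] by blast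
    have "V S (max s t # xs) = Suc v"
      unfolding V[OF S(1)]
    proof
      show "E S (max s t # xs) \<noteq> 0"
        using approximates_mono[OF E[OF S(2)] len _ t, of "max s t"] by simp
      show "\<forall>i\<in>S. G i (max s t # xs) = Suc v"
        using s S(2) approximates_mono[OF G len, of _ s "max s t" v] by auto
    qed
    then have "F (max s t # xs) \<noteq> 0"
      using F_nz S(1) by (metis Zero_not_Suc)
    \<comment> \<open>The search may stop at another stage and with another index set than
      \<open>S\<close>; it remains to see that its value is still \<open>v\<close>.\<close>
    then obtain u r where u: "h xs = Some u" "F (r # xs) = Suc u"
      using h[OF len] by blast
    then obtain K where K: "K \<in> \<K>" "V K (r # xs) = Suc u"
      using F_V by (metis Zero_not_Suc)
    then have KI: "K \<subseteq> I" and E_K: "E K (r # xs) \<noteq> 0" and G_K: "\<forall>i\<in>K. G i (r # xs) = Suc u"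
      using V by (auto simp: \<K>_def)
    have "e K xs = Some (E K (r # xs) - 1)"
      unfolding approximates_iff[OF E[OF KI] len] using E_K by (intro exI[of _ r]) simp
    then have "xs \<notin> (\<Union>i\<in>I - K. A i) - (\<Union>i\<in>K. A i)"
      using e[OF KI] unfolding separates_def by blast
    \<comment> \<open>If \<open>K\<close> missed \<open>S\<close>, then \<open>xs\<close> would lie
      in no \<open>A i\<close> with \<open>i \<in> K\<close>, but in some \<open>A i\<close> with
      \<open>i \<in> I - K\<close>, as \<open>S\<close> is nonempty.\<close>
    then obtain i where i: "i \<in> K" "i \<in> S"
      using S KI unfolding S_def \<K>_def by blast
    then have "g i xs = Some u"
      using approximates_iff[OF G len, of i] G_K KI by auto
    then show ?thesis
      using g_S[OF i(2)] u(1) by simp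
  qed
  have "f = h |` dom f"
  proof
    show "f xs = (h |` dom f) xs" for xs
      using ext by (cases "f xs") (auto simp: restrict_map_def dom_def)
  qed
  then show "potentially_partial_recursive n f"
    using h_rec unfolding potentially_partial_recursive_def by blast
qed

theorem theoremA1:
  fixes n :: nat and I :: "'i set" and A :: "'i \<Rightarrow> nat list set"
  assumes "n > 0"
    and "finite I"
    and "\<And>i. i \<in> I \<Longrightarrow> A i \<subseteq> tuples n"
  shows "strongly_join_permitting {f. potentially_partial_recursive n f} (A ` I) \<longleftrightarrow>
    (\<forall>K\<subseteq>I. \<exists>H. recursively_enumerable n H \<and>
       separates H ((\<Union>i\<in>K. A i) - (\<Union>i\<in>I - K. A i)) ((\<Union>i\<in>I - K. A i) - (\<Union>i\<in>K. A i)))"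
proof (intro iffI allI impI)
  fix K
  assume "strongly_join_permitting {f. potentially_partial_recursive n f} (A ` I)" and "K \<subseteq> I"
  then show "\<exists>H. recursively_enumerable n H \<and>
      separates H ((\<Union>i\<in>K. A i) - (\<Union>i\<in>I - K. A i)) ((\<Union>i\<in>I - K. A i) - (\<Union>i\<in>K. A i))"
    using separation_if_strongly_join_permitting assms(3) by metis
qed (simp add: strongly_join_permitting_if_separation assms(2,3))

end
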